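(* Let $k \geq 2$ be an integer and let $\mathcal{F}$ be a class of graphs. There exists a $k$-universal graph for $\mathcal{F}$ if and only if there is an absolute constant $r$ such that $\chi_a(G) \leq r$ for every $G \in \mathcal{F}$.
   Context: All graphs are finite and have no loops or multiple edges. A class of graphs is a nonempty set of graphs. For $k\in\mathbb{N}$, $[k]=\{1,\ldots,k\}$. A $k$-edge-colored graph is a pair $(G,c)$ where $G$ is a graph (the underlying graph) and $c:E(G)\to[k]$ is an arbitrary mapping (not required to be a proper edge coloring). A homomorphism of a $k$-edge-colored graph $(G_1,c_1)$ to a $k$-edge-colored graph $(G_2,c_2)$ is a mapping $h:V(G_1)\to V(G_2)$ such that for every two vertices $u,v$ adjacent in $G_1$, $h(u)$ and $h(v)$ are adjacent in $G_2$ and $c_1(\{u,v\})=c_2(\{h(u),h(v)\})$. A $k$-edge-colored graph $\mathbb{H}$ (finite, with underlying graph not necessarily in $\mathcal{F}$) is $k$-universal for $\mathcal{F}$ if every $k$-edge-colored graph whose underlying graph is in $\mathcal{F}$ admits a homomorphism to $\mathbb{H}$. An acyclic coloring of a graph is an assignment of colors to its vertices such that adjacent vertices get different colors and the vertices of any cycle get at least $3$ different colors. The acyclic chromatic number $\chi_a(G)$ is the minimum number of colors in an acyclic coloring of $G$. *)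

theory Defs
  imports Main
begin

record 'a ugraph =
  verts :: "'a set"
  edges :: "'a set set"

definition simple_graph :: "'a ugraph \<Rightarrow> bool" where
  "simple_graph G \<longleftrightarrow>
     finite (verts G) \<and> (\<forall>e\<in>edges G. e \<subseteq> verts G \<and> card e = 2)"

definition adjacent :: "'a ugraph \<Rightarrow> 'a \<Rightarrow> 'a \<Rightarrow> bool" where
  "adjacent G u v \<longleftrightarrow> {u, v} \<in> edges G"

definition graph_class :: "'a ugraph set \<Rightarrow> bool" where
  "graph_class F \<longleftrightarrow> F \<noteq> {} \<and> (\<forall>G\<in>F. simple_graph G)"

(* The colour of an edge is only meaningful on edges of the underlying graph;
   the values of the colour function elsewhere are never used. *)
type_synonym 'a ecgraph = "'a ugraph \<times> ('a set \<Rightarrow> nat)"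

definition edge_colored_graph :: "nat \<Rightarrow> 'a ecgraph \<Rightarrow> bool" where
  "edge_colored_graph k = (\<lambda>(G, c). simple_graph G \<and> (\<forall>e\<in>edges G. c e \<in> {1..k}))"

definition ec_hom :: "'a ecgraph \<Rightarrow> 'b ecgraph \<Rightarrow> ('a \<Rightarrow> 'b) \<Rightarrow> bool" where
  "ec_hom = (\<lambda>(G1, c1) (G2, c2) h.
     (\<forall>v\<in>verts G1. h v \<in> verts G2) \<and>
     (\<forall>u\<in>verts G1. \<forall>v\<in>verts G1. adjacent G1 u v \<longrightarrow>
        adjacent G2 (h u) (h v) \<and> c1 {u, v} = c2 {h u, h v}))"

(* The universal graph need not belong to the class, and its vertex type may differ
   from that of the class. *)
definition universal_for :: "nat \<Rightarrow> 'a ugraph set \<Rightarrow> 'b ecgraph \<Rightarrow> bool" where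
  "universal_for k F H \<longleftrightarrow>
     edge_colored_graph k H \<and>
     (\<forall>G\<in>F. \<forall>c. edge_colored_graph k (G, c) \<longrightarrow> (\<exists>h. ec_hom (G, c) H h))"

(* A cycle is listed by its vertices once around, without repeating the first one. *)
definition is_cycle :: "'a ugraph \<Rightarrow> 'a list \<Rightarrow> bool" where
  "is_cycle G p \<longleftrightarrow>
     length p \<ge> 3 \<and> distinct p \<and> set p \<subseteq> verts G \<and>
     (\<forall>i<length p. adjacent G (p ! i) (p ! (Suc i mod length p)))"

definition acyclic_coloring :: "'a ugraph \<Rightarrow> ('a \<Rightarrow> nat) \<Rightarrow> bool" where
  "acyclic_coloring G f \<longleftrightarrow>
     (\<forall>u\<in>verts G. \<forall>v\<in>verts G. adjacent G u v \<longrightarrow> f u \<noteq> f v) \<and>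
     (\<forall>p. is_cycle G p \<longrightarrow> card (f ` set p) \<ge> 3)"

(* On a simple graph an injective f is an acyclic colouring, so the minimum exists. *)
definition acyclic_chromatic_number :: "'a ugraph \<Rightarrow> nat" where
  "acyclic_chromatic_number G =
     (LEAST m. \<exists>f. acyclic_coloring G f \<and> card (f ` verts G) = m)"

end

theory Submission
  imports Defs "HOL-Library.FuncSet"
begin

text \<open>
  If acyclic colourings with \<open>r\<close> colours exist, a universal graph is built in the manner of Alon and
  Marshall. Any two colour classes induce a forest, and on a forest every edge colouring with
  values modulo \<open>k\<close> is a sum of vertex weights at the two ends: prune a leaf, solve the rest, and
  choose the weight of the leaf to fit its only edge (\<open>forest_edge_potential\<close>). A vertex of
  colour \<open>i\<close> therefore only has to remember \<open>i\<close> and its weight in the forest of each pair \<open>{i, j}\<close>;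
  from two such records of different colours the edge colour is computed by one addition. The
  finitely many records are the vertices of the universal graph (\<open>hom_to_universal_ecgraph\<close>).

  Conversely, let a universal graph have \<open>n\<close> vertices. A homomorphism determines the edge colouring
  it respects, so comparing the number of 2-colourings of the edges inside a vertex set \<open>W\<close> with the
  number of maps from \<open>W\<close> gives at most \<open>n * card W\<close> such edges (\<open>universal_edge_bound\<close>). Hence
  every nonempty \<open>W\<close> has a vertex on at most \<open>D = 2 * n\<close> edges inside \<open>W\<close>, and inserting vertices one
  at a time labels the edges with \<open>D\<close> labels, each forming a forest (\<open>degenerate_forest_labelling\<close>). For
  each label take a homomorphism for the edge colouring that singles out this label, and colour
  each vertex by its tuple of \<open>D\<close> images. The tuples at the ends of an edge reveal its label, so all
  edges between two tuple classes have the same label. A cycle with only two tuples would thus lie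
  in one of the forests; so the tuples are an acyclic colouring with at most \<open>n ^ D\<close> colours
  (\<open>bounded_if_universal\<close>).
\<close>

section \<open>Cycles and leaves\<close>

lemma adjacent_sym: "adjacent G u v \<longleftrightarrow> adjacent G v u"
  by (simp add: adjacent_def insert_commute)

lemma adjacent_simple:
  assumes "simple_graph G" "adjacent G u v"
  shows "u \<in> verts G" "v \<in> verts G" "u \<noteq> v"
proof -
  have "{u, v} \<subseteq> verts G \<and> card {u, v} = 2"
    using assms unfolding simple_graph_def adjacent_def by blast
  then show "u \<in> verts G" "v \<in> verts G" "u \<noteq> v" by auto
qed

lemma edge_endpoints:
  assumes "simple_graph G" "e \<in> edges G"
  obtains u v where "e = {u, v}" "u \<noteq> v" "u \<in> verts G" "v \<in> verts G" "adjacent G u v"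
proof -
  have "card e = 2" "e \<subseteq> verts G" using assms unfolding simple_graph_def by auto
  then obtain u v where "e = {u, v}" "u \<noteq> v" by (auto simp: card_2_iff)
  with that assms(2) \<open>e \<subseteq> verts G\<close> show thesis by (auto simp: adjacent_def)
qed

lemma simple_graph_finite_edges:
  assumes "simple_graph G" shows "finite (edges G)"
proof -
  have "edges G \<subseteq> Pow (verts G)" using assms by (auto simp: simple_graph_def)
  then show ?thesis using assms by (auto simp: simple_graph_def intro: finite_subset)
qed

lemma cycle_two_neighbours:
  assumes "is_cycle G p" "v \<in> set p"
  shows "\<exists>u\<in>set p. \<exists>w\<in>set p. u \<noteq> w \<and> adjacent G u v \<and> adjacent G v w"
proof -
  let ?n = "length p"
  have n: "?n \<ge> 3" and d: "distinct p"
    and adj: "\<And>i. i < ?n \<Longrightarrow> adjacent G (p ! i) (p ! (Suc i mod ?n))"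
    using assms(1) by (auto simp: is_cycle_def)
  obtain j where j: "j < ?n" "p ! j = v" using assms(2) by (auto simp: in_set_conv_nth)
  define i where "i = (if j = 0 then ?n - 1 else j - 1)"
  have i: "i < ?n" "Suc i mod ?n = j" using n j by (auto simp: i_def)
  have k: "Suc j mod ?n < ?n" using n by (intro mod_less_divisor) auto
  have "i \<noteq> Suc j mod ?n"
    using n j by (auto simp: i_def mod_Suc split: if_splits)
  then have "p ! i \<noteq> p ! (Suc j mod ?n)" using d i k by (simp add: nth_eq_iff_index_eq)
  moreover have "adjacent G (p ! i) v" using adj[OF i(1)] i j by simp
  moreover have "adjacent G v (p ! (Suc j mod ?n))" using adj[OF j(1)] j by simp
  ultimately show ?thesis using i k by (meson nth_mem)
qed

text \<open>The first vertex of a longest path in \<open>W\<close> is a leaf: all its neighbours lie on the path by maximality,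
and a neighbour other than the second vertex would close a cycle.\<close>

lemma acyclic_has_leaf:
  assumes "simple_graph G" "finite W" "W \<noteq> {}" "W \<subseteq> verts G"
    and nocyc: "\<And>p. is_cycle G p \<Longrightarrow> \<not> set p \<subseteq> W"
  shows "\<exists>v\<in>W. \<forall>u\<in>W. \<forall>u'\<in>W. adjacent G v u \<longrightarrow> adjacent G v u' \<longrightarrow> u = u'"
proof -
  define path where
    "path p \<longleftrightarrow> p \<noteq> [] \<and> distinct p \<and> set p \<subseteq> W \<and> successively (adjacent G) p" for p
  obtain w where "w \<in> W" using assms by auto
  then have "path [w]" by (simp add: path_def)
  moreover have "\<forall>p. path p \<longrightarrow> length p < Suc (card W)"
    using card_mono[OF assms(2)] by (metis path_def distinct_card less_Suc_eq_le)
  ultimately obtain p where p: "path p" and longest: "\<And>q. path q \<Longrightarrow> length q \<le> length p"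
    using ex_has_greatest_nat[of path "[w]" length] by metis
  obtain v ps where vps: "p = v # ps" using p by (cases p) (auto simp: path_def)
  have vW: "v \<in> W" using p by (simp add: path_def vps)
  have second: "u = hd ps \<and> ps \<noteq> []" if u: "u \<in> W" "adjacent G v u" for u
  proof -
    have "u \<in> set p"
    proof (rule ccontr)
      assume "u \<notin> set p"
      then have "path (u # p)"
        using p u by (simp add: path_def vps adjacent_sym)
      then show False using longest[of "u # p"] by simp
    qed
    then obtain m where m: "m < length p" "p ! m = u" by (auto simp: in_set_conv_nth)
    have "m \<noteq> 0"
      using m adjacent_simple(3)[OF assms(1) u(2)] by (metis nth_Cons_0 vps)
    moreover have "\<not> m \<ge> 2"
    proof
      assume m2: "m \<ge> 2"
      let ?c = "take (Suc m) p"
      have len: "length ?c = Suc m" using m by simp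
      have "adjacent G (?c ! i) (?c ! (Suc i mod length ?c))" if "i < length ?c" for i
      proof (cases "i = m")
        case True
        from True have "?c ! i = u" "?c ! (Suc i mod length ?c) = p ! 0" using m len by simp_all
        moreover have "p ! 0 = v" by (simp add: vps)
        ultimately show ?thesis using u adjacent_sym[of G u v] by simp
      next
        case False
        then have "i < m" using that len by simp
        then have "adjacent G (p ! i) (p ! Suc i)"
          using p m by (simp add: path_def successively_conv_nth)
        then show ?thesis using \<open>i < m\<close> m len by simp
      qed
      then have "is_cycle G ?c"
        using p m m2 len assms(4) set_take_subset[of "Suc m" p]
        unfolding is_cycle_def path_def by auto
      moreover have "set ?c \<subseteq> W" using p set_take_subset[of "Suc m" p] by (auto simp: path_def)
      ultimately show False using nocyc by blast
    qed
    ultimately have "m = 1" by simp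
    then show ?thesis using m by (cases ps) (auto simp: vps)
  qed
  show ?thesis using vW second by metis
qed

text \<open>The weights are built up leaf by leaf: the weight of a leaf is subject to a single equation. Taking
a vertex subset \<open>W\<close> instead of an induced subgraph keeps the induction inside one graph.\<close>

lemma forest_edge_potential:
  fixes c :: "'a set \<Rightarrow> nat"
  assumes "simple_graph G" "finite W" "W \<subseteq> verts G" "k > 0"
    and "\<And>p. is_cycle G p \<Longrightarrow> \<not> set p \<subseteq> W"
  shows "\<exists>\<phi> :: 'a \<Rightarrow> nat. (\<forall>v. \<phi> v < k) \<and>
           (\<forall>u\<in>W. \<forall>v\<in>W. adjacent G u v \<longrightarrow> (\<phi> u + \<phi> v) mod k = c {u, v} mod k)"
  using assms(2,3,5)
proof (induction W rule: finite_psubset_induct)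
  case (psubset W)
  show ?case
  proof (cases "W = {}")
    case True
    then show ?thesis using \<open>k > 0\<close> by (intro exI[of _ "\<lambda>_. 0"]) auto
  next
    case False
    then obtain v where v: "v \<in> W"
      and leaf: "\<And>u u'. u \<in> W \<Longrightarrow> u' \<in> W \<Longrightarrow> adjacent G v u \<Longrightarrow> adjacent G v u' \<Longrightarrow> u = u'"
      using acyclic_has_leaf[OF assms(1) psubset.hyps False psubset.prems] by blast
    have "W - {v} \<subset> W" using v by auto
    moreover have "W - {v} \<subseteq> verts G" using psubset.prems by auto
    moreover have "\<not> set p \<subseteq> W - {v}" if "is_cycle G p" for p
      using psubset.prems(2)[OF that] by auto
    ultimately obtain \<phi> where lt: "\<And>x. \<phi> x < k" and \<phi>:
      "\<And>x y. x \<in> W - {v} \<Longrightarrow> y \<in> W - {v} \<Longrightarrow> adjacent G x y \<Longrightarrow> (\<phi> x + \<phi> y) mod k = c {x, y} mod k"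
      using psubset.IH by meson
    show ?thesis
    proof (cases "\<exists>u\<in>W. adjacent G v u")
      case False
      then have "x \<in> W - {v} \<and> y \<in> W - {v}" if "x \<in> W" "y \<in> W" "adjacent G x y" for x y
        using that adjacent_sym[of G x y] by blast
      then show ?thesis using lt \<phi> by (metis (no_types, lifting))
    next
      case True
      then obtain u where u: "u \<in> W" "adjacent G v u" by blast
      have uv: "u \<noteq> v" using adjacent_simple(3)[OF assms(1) u(2)] by simp
      \<comment> \<open>The summand \<open>k - \<phi> u\<close> stands for \<open>- \<phi> u\<close> modulo \<open>k\<close>, without truncated subtraction.\<close>
      define \<psi> where "\<psi> = \<phi>(v := (c {u, v} + (k - \<phi> u)) mod k)"
      have at_leaf: "(\<psi> u + \<psi> v) mod k = c {u, v} mod k"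
      proof -
        have "\<phi> u + (c {u, v} + (k - \<phi> u)) = c {u, v} + k" using lt[of u] by simp
        then show ?thesis using uv by (simp add: \<psi>_def mod_add_right_eq)
      qed
      have "(\<psi> x + \<psi> y) mod k = c {x, y} mod k" if xy: "x \<in> W" "y \<in> W" "adjacent G x y" for x y
      proof -
        consider "x = v" | "y = v" | "x \<noteq> v" "y \<noteq> v" by blast
        then show ?thesis
        proof cases
          case 1
          then have "y = u" using leaf u xy by blast
          then show ?thesis using 1 at_leaf by (simp add: add.commute insert_commute)
        next
          case 2
          then have "x = u" using leaf u xy adjacent_sym by metis
          then show ?thesis using 2 at_leaf by simp
        next
          case 3
          then show ?thesis using \<phi>[of x y] xy by (simp add: \<psi>_def)
        qed
      qed
      moreover have "\<psi> x < k" for x using lt \<open>k > 0\<close> by (simp add: \<psi>_def)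
      ultimately show ?thesis by blast
    qed
  qed
qed

section \<open>Acyclic colourings\<close>

text \<open>Colours of any type may be used, since the finitely many that occur can be renumbered. This admits
tuples as colours.\<close>

lemma acyclic_chromatic_number_le:
  fixes f :: "'a \<Rightarrow> 'b"
  assumes "simple_graph G"
    and proper: "\<And>u v. adjacent G u v \<Longrightarrow> f u \<noteq> f v"
    and cyc: "\<And>p. is_cycle G p \<Longrightarrow> card (f ` set p) \<ge> 3"
  shows "acyclic_chromatic_number G \<le> card (f ` verts G)"
proof -
  have "finite (f ` verts G)" using assms(1) by (simp add: simple_graph_def)
  then obtain g :: "'b \<Rightarrow> nat" where g: "inj_on g (f ` verts G)"
    using finite_imp_inj_to_nat_seg by blast
  have "card ((g \<circ> f) ` set p) \<ge> 3" if "is_cycle G p" for p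
  proof -
    have "f ` set p \<subseteq> f ` verts G" using that by (auto simp: is_cycle_def)
    then have "card (g ` f ` set p) = card (f ` set p)"
      using card_image inj_on_subset[OF g] by blast
    then show ?thesis using cyc[OF that] by (simp add: image_comp)
  qed
  moreover have "(g \<circ> f) u \<noteq> (g \<circ> f) v" if "u \<in> verts G" "v \<in> verts G" "adjacent G u v" for u v
    using that proper[OF that(3)] inj_onD[OF g, of "f u" "f v"] by auto
  ultimately have "acyclic_coloring G (g \<circ> f)" by (simp add: acyclic_coloring_def)
  moreover have "card ((g \<circ> f) ` verts G) = card (f ` verts G)"
    using card_image[OF g] by (simp add: image_comp)
  ultimately show ?thesis unfolding acyclic_chromatic_number_def by (intro Least_le) blast
qed

lemma acyclic_coloring_exists:
  assumes "simple_graph G" "acyclic_chromatic_number G \<le> r"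
  obtains f where "acyclic_coloring G f" "f ` verts G \<subseteq> {..<r}"
proof -
  have fin: "finite (verts G)" using assms(1) by (simp add: simple_graph_def)
  then obtain f0 :: "'a \<Rightarrow> nat" where f0: "inj_on f0 (verts G)"
    using finite_imp_inj_to_nat_seg by blast
  have "card (f0 ` set p) \<ge> 3" if "is_cycle G p" for p
  proof -
    have "card (f0 ` set p) = card (set p)"
      using that by (intro card_image inj_on_subset[OF f0]) (simp add: is_cycle_def)
    then show ?thesis using that by (simp add: is_cycle_def distinct_card)
  qed
  then have "acyclic_coloring G f0"
    using adjacent_simple(3)[OF assms(1)] inj_onD[OF f0] unfolding acyclic_coloring_def by blast
  then have "\<exists>m f. acyclic_coloring G f \<and> card (f ` verts G) = m" by blast
  then have "\<exists>f. acyclic_coloring G f \<and> card (f ` verts G) = acyclic_chromatic_number G"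
    unfolding acyclic_chromatic_number_def by (rule LeastI_ex)
  then obtain f where f: "acyclic_coloring G f" "card (f ` verts G) \<le> r" using assms(2) by auto
  obtain g where g: "inj_on g (f ` verts G)" "g ` f ` verts G \<subseteq> {..<r}"
    using card_le_inj[of "f ` verts G" "{..<r}"] fin f(2) by auto
  have "card ((g \<circ> f) ` set p) \<ge> 3" if "is_cycle G p" for p
  proof -
    have "f ` set p \<subseteq> f ` verts G" using that by (auto simp: is_cycle_def)
    then have "card (g ` f ` set p) = card (f ` set p)"
      using card_image inj_on_subset[OF g(1)] by blast
    then show ?thesis using f(1) that by (simp add: image_comp acyclic_coloring_def)
  qed
  moreover have "(g \<circ> f) u \<noteq> (g \<circ> f) v" if "u \<in> verts G" "v \<in> verts G" "adjacent G u v" for u v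
    using that f(1) inj_onD[OF g(1), of "f u" "f v"] by (auto simp: acyclic_coloring_def)
  ultimately have "acyclic_coloring G (g \<circ> f)" by (simp add: acyclic_coloring_def)
  then show thesis using that g(2) by (simp add: image_comp)
qed

section \<open>From acyclic colourings to a universal graph\<close>

text \<open>In a vertex \<open>(i, xs)\<close>, \<open>i\<close> is the colour in an acyclic colouring and \<open>xs ! j\<close> the weight in the forest
induced by the colours \<open>i\<close> and \<open>j\<close>; the entry at \<open>j = i\<close> is a filler.\<close>

definition universal_verts :: "nat \<Rightarrow> nat \<Rightarrow> (nat \<times> nat list) set" where
  "universal_verts k r = {..<r} \<times> {xs. set xs \<subseteq> {..<k} \<and> length xs = r}"

text \<open>Edge colours start at 1 and residues at 0, hence the successor.\<close>

definition pair_color :: "nat \<Rightarrow> nat \<times> nat list \<Rightarrow> nat \<times> nat list \<Rightarrow> nat" where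
  "pair_color k x y = Suc ((snd x ! fst y + snd y ! fst x) mod k)"

text \<open>Edge colours are functions of the unordered pair; the description is well defined because
\<open>pair_color\<close> is symmetric.\<close>

definition universal_ecgraph :: "nat \<Rightarrow> nat \<Rightarrow> (nat \<times> nat list) ecgraph" where
  "universal_ecgraph k r =
     (\<lparr>verts = universal_verts k r,
       edges = {{x, y} | x y. x \<in> universal_verts k r \<and> y \<in> universal_verts k r \<and> fst x \<noteq> fst y}\<rparr>,
      \<lambda>e. THE m. \<exists>x y. e = {x, y} \<and> m = pair_color k x y)"

lemma pair_color_commute: "pair_color k x y = pair_color k y x"
  by (simp add: pair_color_def add.commute)

lemma universal_ecgraph_color: "snd (universal_ecgraph k r) {x, y} = pair_color k x y"
proof -
  have "(THE m. \<exists>x' y'. {x, y} = {x', y'} \<and> m = pair_color k x' y') = pair_color k x y"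
    by (rule the_equality) (blast, metis doubleton_eq_iff pair_color_commute)
  then show ?thesis by (simp add: universal_ecgraph_def)
qed

lemma universal_ecgraph_colored:
  assumes "k > 0" shows "edge_colored_graph k (universal_ecgraph k r)"
proof -
  have "finite (universal_verts k r)"
    by (auto simp: universal_verts_def intro: finite_lists_length_eq)
  then have "simple_graph (fst (universal_ecgraph k r))"
    by (auto simp: simple_graph_def universal_ecgraph_def card_2_iff)
  moreover have "snd (universal_ecgraph k r) e \<in> {1..k}"
    if e: "e \<in> edges (fst (universal_ecgraph k r))" for e
  proof -
    obtain x y where "e = {x, y}" using e by (auto simp: universal_ecgraph_def)
    then show ?thesis using assms by (simp add: universal_ecgraph_color pair_color_def Suc_le_eq)
  qed
  ultimately show ?thesis by (auto simp: edge_colored_graph_def case_prod_unfold)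
qed

lemma hom_to_universal_ecgraph:
  assumes "k > 0" "edge_colored_graph k (G, c)" "acyclic_chromatic_number G \<le> r"
  shows "\<exists>h. ec_hom (G, c) (universal_ecgraph k r) h"
proof -
  have G: "simple_graph G" and c: "\<And>e. e \<in> edges G \<Longrightarrow> c e \<in> {1..k}"
    using assms(2) by (auto simp: edge_colored_graph_def)
  have fin: "finite (verts G)" using G by (simp add: simple_graph_def)
  obtain f where f: "acyclic_coloring G f" "f ` verts G \<subseteq> {..<r}"
    using acyclic_coloring_exists[OF G assms(3)] .
  define W where "W i j = {v \<in> verts G. f v = i \<or> f v = j}" for i j
  \<comment> \<open>A cycle inside two colour classes would carry at most two colours.\<close>
  have forest: "\<not> set p \<subseteq> W i j" if p: "is_cycle G p" for p i j
  proof
    assume "set p \<subseteq> W i j"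
    then have "f ` set p \<subseteq> {i, j}" by (auto simp: W_def)
    then have "card (f ` set p) \<le> card {i, j}" by (intro card_mono) auto
    also have "\<dots> \<le> 2" by (simp add: card_insert_if)
    finally show False using f(1) p by (auto simp: acyclic_coloring_def)
  qed
  have "\<exists>\<phi> :: 'a \<Rightarrow> nat. (\<forall>v. \<phi> v < k) \<and> (\<forall>u\<in>W i j. \<forall>v\<in>W i j. adjacent G u v \<longrightarrow>
          (\<phi> u + \<phi> v) mod k = (c {u, v} - 1) mod k)" for i j
    using forest_edge_potential[OF G, of "W i j" k "\<lambda>e. c e - 1"] forest fin assms(1)
    by (auto simp: W_def)
  then obtain \<phi> :: "nat \<Rightarrow> nat \<Rightarrow> 'a \<Rightarrow> nat" where lt: "\<And>i j v. \<phi> i j v < k"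
    and \<phi>: "\<And>i j u v. u \<in> W i j \<Longrightarrow> v \<in> W i j \<Longrightarrow> adjacent G u v \<Longrightarrow>
              (\<phi> i j u + \<phi> i j v) mod k = (c {u, v} - 1) mod k"
    by metis
  \<comment> \<open>Both ends of an edge must use the same weights, so the pair of colours is put in order.\<close>
  define h where
    "h v = (f v, map (\<lambda>j. \<phi> (min (f v) j) (max (f v) j) v) [0..<r])" for v
  have hv: "h v \<in> universal_verts k r" if "v \<in> verts G" for v
    using that f(2) lt by (auto simp: h_def universal_verts_def)
  have "ec_hom (G, c) (universal_ecgraph k r) h"
  proof -
    have "adjacent (fst (universal_ecgraph k r)) (h u) (h v) \<and>
          c {u, v} = snd (universal_ecgraph k r) {h u, h v}"
      if uv: "u \<in> verts G" "v \<in> verts G" "adjacent G u v" for u v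
    proof
      have ne: "f u \<noteq> f v" using f(1) uv by (simp add: acyclic_coloring_def)
      then have "fst (h u) \<noteq> fst (h v)" by (simp add: h_def)
      then show "adjacent (fst (universal_ecgraph k r)) (h u) (h v)"
        using hv[OF uv(1)] hv[OF uv(2)] unfolding adjacent_def universal_ecgraph_def
        by (simp del: split_paired_Ex) blast
      let ?i = "min (f u) (f v)" and ?j = "max (f u) (f v)"
      have "u \<in> W ?i ?j" "v \<in> W ?i ?j" using uv by (auto simp: W_def min_def max_def)
      then have eq: "(\<phi> ?i ?j u + \<phi> ?i ?j v) mod k = (c {u, v} - 1) mod k" using \<phi> uv by blast
      have fr: "f u < r" "f v < r" using uv f(2) by auto
      have "c {u, v} \<in> {1..k}" using c uv by (simp add: adjacent_def)
      then have "c {u, v} = Suc ((c {u, v} - 1) mod k)" by auto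
      also have "\<dots> = pair_color k (h u) (h v)"
        using eq fr by (simp add: pair_color_def h_def min.commute max.commute)
      finally show "c {u, v} = snd (universal_ecgraph k r) {h u, h v}"
        by (simp add: universal_ecgraph_color)
    qed
    then show ?thesis using hv
      by (auto simp: ec_hom_def case_prod_unfold) (simp_all add: universal_ecgraph_def)
  qed
  then show ?thesis by blast
qed

lemma edge_colored_graph_on_nat:
  fixes H :: "'b ecgraph"
  assumes "edge_colored_graph k H"
  obtains H' :: "nat ecgraph" and g :: "'b \<Rightarrow> nat"
  where "edge_colored_graph k H'" "ec_hom H H' g"
proof -
  obtain K d where H: "H = (K, d)" by (cases H)
  have K: "simple_graph K" and d: "\<And>e. e \<in> edges K \<Longrightarrow> d e \<in> {1..k}"
    using assms by (auto simp: edge_colored_graph_def H)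
  have fin: "finite (verts K)" using K by (simp add: simple_graph_def)
  then obtain g :: "'b \<Rightarrow> nat" where g: "inj_on g (verts K)"
    using finite_imp_inj_to_nat_seg by blast
  define K' where "K' = \<lparr>verts = g ` verts K, edges = (`) g ` edges K\<rparr>"
  define d' where "d' e = d (inv_into (verts K) g ` e)" for e
  have sub: "e \<subseteq> verts K" "card e = 2" if "e \<in> edges K" for e
    using K that by (auto simp: simple_graph_def)
  have d'_eq: "d' (g ` e) = d e" if "e \<in> edges K" for e
    using inv_into_image_cancel[OF g sub(1)[OF that]] by (simp add: d'_def)
  have "card (g ` e) = 2" if "e \<in> edges K" for e
    using card_image[OF inj_on_subset[OF g sub(1)[OF that]]] sub(2)[OF that] by simp
  moreover have "g ` e \<subseteq> g ` verts K" if "e \<in> edges K" for e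
    using sub(1)[OF that] by (rule image_mono)
  ultimately have "simple_graph K'" using fin by (simp add: simple_graph_def K'_def)
  then have "edge_colored_graph k (K', d')"
    using d d'_eq by (auto simp: edge_colored_graph_def K'_def)
  moreover have "ec_hom H (K', d') g"
  proof -
    have "adjacent K' (g u) (g v) \<and> d {u, v} = d' {g u, g v}" if "adjacent K u v" for u v
    proof -
      have e: "{u, v} \<in> edges K" using that by (simp add: adjacent_def)
      then have "g ` {u, v} \<in> edges K'" unfolding K'_def ugraph.select_convs by (rule imageI)
      then show ?thesis using d'_eq[OF e] by (simp add: adjacent_def)
    qed
    then show ?thesis by (auto simp: ec_hom_def H) (simp add: K'_def)
  qed
  ultimately show thesis by (rule that)
qed

lemma ec_hom_trans:
  assumes "ec_hom A B h" "ec_hom B C g"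
  shows "ec_hom A C (g \<circ> h)"
proof -
  obtain G c where A: "A = (G, c)" by (cases A)
  obtain K d where B: "B = (K, d)" by (cases B)
  obtain L e where C: "C = (L, e)" by (cases C)
  have h: "h v \<in> verts K" if "v \<in> verts G" for v
    using assms(1) that by (simp add: A B C ec_hom_def)
  have he: "adjacent K (h u) (h v) \<and> c {u, v} = d {h u, h v}"
    if "u \<in> verts G" "v \<in> verts G" "adjacent G u v" for u v
    using assms(1) that unfolding A B C ec_hom_def prod.case by blast
  have g: "g v \<in> verts L" if "v \<in> verts K" for v
    using assms(2) that by (simp add: A B C ec_hom_def)
  have ge: "adjacent L (g u) (g v) \<and> d {u, v} = e {g u, g v}"
    if "u \<in> verts K" "v \<in> verts K" "adjacent K u v" for u v
    using assms(2) that unfolding A B C ec_hom_def prod.case by blast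
  show ?thesis
    unfolding A B C ec_hom_def prod.case comp_apply
    using h g he ge[OF h h] by auto
qed

lemma universal_if_bounded:
  assumes "k > 0" "\<And>G. G \<in> F \<Longrightarrow> acyclic_chromatic_number G \<le> r"
  shows "\<exists>H :: nat ecgraph. universal_for k F H"
proof -
  obtain H :: "nat ecgraph" and g where "edge_colored_graph k H" "ec_hom (universal_ecgraph k r) H g"
    using edge_colored_graph_on_nat[OF universal_ecgraph_colored[OF assms(1)]] .
  then have "universal_for k F H"
    unfolding universal_for_def
    using hom_to_universal_ecgraph[OF assms(1)] assms(2) ec_hom_trans by blast
  then show ?thesis ..
qed

section \<open>From a universal graph to acyclic colourings\<close>

text \<open>The edge colourings of \<open>W\<close> with colours 1 and 2 correspond to edge sets \<open>S\<close>, and the homomorphism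
chosen for \<open>S\<close>, restricted to \<open>W\<close>, determines \<open>S\<close>. So \<open>2 ^ card E \<le> n ^ card W\<close>; the crude estimate
\<open>n \<le> 2 ^ n\<close> replaces a logarithm.\<close>

lemma universal_edge_bound:
  assumes "k \<ge> 2" "universal_for k F H" "G \<in> F" "simple_graph G" "W \<subseteq> verts G"
  shows "card {e \<in> edges G. e \<subseteq> W} \<le> card (verts (fst H)) * card W"
proof -
  let ?E = "{e \<in> edges G. e \<subseteq> W}" and ?V = "verts (fst H)"
  let ?n = "card ?V"
  have finE: "finite ?E" using simple_graph_finite_edges[OF assms(4)] by simp
  have finW: "finite W" using assms(4,5) by (auto simp: simple_graph_def intro: finite_subset)
  have finV: "finite ?V"
    using assms(2) by (auto simp: universal_for_def edge_colored_graph_def simple_graph_def)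
  define c where "c S e = (if e \<in> S then 1 else 2 :: nat)" for S and e :: "'a set"
  have "\<exists>h. ec_hom (G, c S) H h" for S
    using assms(1-4) by (auto simp: universal_for_def edge_colored_graph_def c_def)
  then obtain h where h: "\<And>S. ec_hom (G, c S) H (h S)" by metis
  define R where "R S = restrict (h S) W" for S
  have "inj_on R (Pow ?E)"
  proof (rule inj_onI)
    fix S T assume S: "S \<in> Pow ?E" and T: "T \<in> Pow ?E" and eq: "R S = R T"
    have "e \<in> S \<longleftrightarrow> e \<in> T" if e: "e \<in> ?E" for e
    proof -
      obtain u v where uv: "e = {u, v}" "u \<in> verts G" "v \<in> verts G" "adjacent G u v"
        using edge_endpoints[OF assms(4)] e by blast
      have "h S u = h T u" "h S v = h T v"
        using eq e uv(1) unfolding R_def by (metis (no_types, lifting) insert_subset mem_Collect_eq restrict_apply')+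
      moreover have "c X e = snd H {h X u, h X v}" for X
        using h[of X] uv by (auto simp: ec_hom_def case_prod_unfold)
      ultimately have "c S e = c T e" by simp
      then show ?thesis by (auto simp: c_def split: if_splits)
    qed
    then show "S = T" using S T by auto
  qed
  moreover have "R ` Pow ?E \<subseteq> W \<rightarrow>\<^sub>E ?V"
    using h assms(5) by (auto simp: R_def ec_hom_def case_prod_unfold)
  ultimately have "card (Pow ?E) \<le> card (W \<rightarrow>\<^sub>E ?V)"
    using finW finV by (intro card_inj_on_le finite_PiE) auto
  then have "2 ^ card ?E \<le> ?n ^ card W"
    using finE finW by (simp add: card_Pow card_funcsetE)
  also have "\<dots> \<le> (2 ^ ?n) ^ card W" by (rule power_mono[OF less_imp_le[OF less_exp]]) simp
  also have "\<dots> = 2 ^ (?n * card W)" by (simp add: power_mult)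
  finally show ?thesis by simp
qed

text \<open>The degrees within \<open>W\<close> sum to twice the number of edges, so their average is at most \<open>2 * n\<close>.\<close>

lemma sparse_imp_low_degree:
  assumes "simple_graph G" "finite W" "W \<noteq> {}"
    and "card {e \<in> edges G. e \<subseteq> W} \<le> n * card W"
  shows "\<exists>v\<in>W. card {e \<in> edges G. e \<subseteq> W \<and> v \<in> e} \<le> 2 * n"
proof (rule ccontr)
  assume "\<not> ?thesis"
  then have big: "\<And>v. v \<in> W \<Longrightarrow> 2 * n < card {e \<in> edges G. e \<subseteq> W \<and> v \<in> e}" by auto
  let ?E = "{e \<in> edges G. e \<subseteq> W}"
  have "card {v \<in> W. v \<in> e} = 2" if "e \<in> ?E" for e
  proof -
    have "{v \<in> W. v \<in> e} = e" using that by auto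
    then show ?thesis using that assms(1) by (simp add: simple_graph_def)
  qed
  then have "(\<Sum>v\<in>W. card {e \<in> ?E. v \<in> e}) = 2 * card ?E"
    using assms(2) simple_graph_finite_edges[OF assms(1)] by (intro sum_multicount) auto
  moreover have "(\<Sum>v\<in>W. 2 * n) < (\<Sum>v\<in>W. card {e \<in> ?E. v \<in> e})"
    using big assms(2,3) by (intro sum_strict_mono) auto
  ultimately show False using assms(4) by (simp add: mult.commute)
qed

definition label_class :: "'a ugraph \<Rightarrow> ('a set \<Rightarrow> nat) \<Rightarrow> nat \<Rightarrow> 'a ugraph" where
  "label_class G l a = G\<lparr>edges := {e \<in> edges G. l e = a}\<rparr>"

text \<open>Remove a vertex \<open>v\<close> of degree at most \<open>D\<close>, label the rest, and give the edges at \<open>v\<close> pairwise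
different labels. A cycle through \<open>v\<close> uses two edges at \<open>v\<close>, which have different labels, so no new
cycle with a single label arises.\<close>

lemma degenerate_forest_labelling:
  assumes "simple_graph G" "finite W"
    and deg: "\<And>U. U \<subseteq> W \<Longrightarrow> U \<noteq> {} \<Longrightarrow> \<exists>v\<in>U. card {e \<in> edges G. e \<subseteq> U \<and> v \<in> e} \<le> D"
  shows "\<exists>l. (\<forall>e\<in>edges G. e \<subseteq> W \<longrightarrow> l e < D) \<and>
             (\<forall>a p. is_cycle (label_class G l a) p \<longrightarrow> \<not> set p \<subseteq> W)"
  using assms(2,3)
proof (induction W rule: finite_psubset_induct)
  case (psubset W)
  show ?case
  proof (cases "W = {}")
    case True
    have "e \<noteq> {}" if "e \<in> edges G" for e
      using that assms(1) by (auto simp: simple_graph_def)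
    then show ?thesis using True by (auto simp: is_cycle_def)
  next
    case False
    then obtain v where v: "v \<in> W" and dv: "card {e \<in> edges G. e \<subseteq> W \<and> v \<in> e} \<le> D"
      using psubset.prems by blast
    let ?N = "{e \<in> edges G. e \<subseteq> W \<and> v \<in> e}"
    have "finite ?N" using simple_graph_finite_edges[OF assms(1)] by simp
    then obtain g where g: "inj_on g ?N" "g ` ?N \<subseteq> {..<D}"
      using card_le_inj[of ?N "{..<D}"] dv by auto
    have "W - {v} \<subset> W" using v by auto
    then have "\<exists>l. (\<forall>e\<in>edges G. e \<subseteq> W - {v} \<longrightarrow> l e < D) \<and>
             (\<forall>a p. is_cycle (label_class G l a) p \<longrightarrow> \<not> set p \<subseteq> W - {v})"
      by (rule psubset.IH) (use psubset.prems in blast)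
    then obtain l where l: "\<And>e. e \<in> edges G \<Longrightarrow> e \<subseteq> W - {v} \<Longrightarrow> l e < D"
      and acyc: "\<And>a p. is_cycle (label_class G l a) p \<Longrightarrow> \<not> set p \<subseteq> W - {v}"
      by blast
    define m where "m e = (if v \<in> e then g e else l e)" for e
    have "m e < D" if "e \<in> edges G" "e \<subseteq> W" for e
      using that l[of e] g(2) by (auto simp: m_def)
    moreover have "\<not> set p \<subseteq> W" if p: "is_cycle (label_class G m a) p" for a p
    proof
      assume pW: "set p \<subseteq> W"
      show False
      proof (cases "v \<in> set p")
        case True
        obtain u w where uw: "u \<in> set p" "w \<in> set p" "u \<noteq> w"
          "adjacent (label_class G m a) u v" "adjacent (label_class G m a) v w"
          using cycle_two_neighbours[OF p True] by blast
        have "{u, v} \<in> ?N" "{v, w} \<in> ?N"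
          using uw pW v by (auto simp: adjacent_def label_class_def)
        moreover have "g {u, v} = g {v, w}"
          using uw(4,5) by (simp add: adjacent_def label_class_def m_def)
        ultimately have "{u, v} = {v, w}" using g(1) by (auto dest: inj_onD)
        then show False using uw(3) by (auto simp: doubleton_eq_iff)
      next
        case False
        have "adjacent (label_class G l a) (p ! i) (p ! (Suc i mod length p))"
          if i: "i < length p" for i
        proof -
          have "p ! i \<in> set p" "p ! (Suc i mod length p) \<in> set p"
            using i by (auto intro!: nth_mem mod_less_divisor)
          then have "v \<notin> {p ! i, p ! (Suc i mod length p)}" using False by auto
          moreover have "adjacent (label_class G m a) (p ! i) (p ! (Suc i mod length p))"
            using p i by (simp add: is_cycle_def)
          ultimately show ?thesis by (simp add: adjacent_def label_class_def m_def)
        qed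
        then have "is_cycle (label_class G l a) p"
          using p by (simp add: is_cycle_def label_class_def)
        then show False using acyc pW False by blast
      qed
    qed
    ultimately show ?thesis by blast
  qed
qed

text \<open>The ends of an edge get different colours, so on a cycle with only two colours each edge sees both.\<close>

lemma two_color_cycle_edges:
  assumes "is_cycle G p" "\<And>u v. adjacent G u v \<Longrightarrow> f u \<noteq> f v" "card (f ` set p) < 3" "i < length p"
  shows "f ` {p ! i, p ! (Suc i mod length p)} = f ` set p"
proof (rule card_subset_eq)
  let ?e = "{p ! i, p ! (Suc i mod length p)}"
  show "finite (f ` set p)" by simp
  have sub: "?e \<subseteq> set p" using assms(4) by (auto intro!: nth_mem mod_less_divisor)
  then show "f ` ?e \<subseteq> f ` set p" by (rule image_mono)
  then have "card (f ` ?e) \<le> card (f ` set p)" by (intro card_mono) auto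
  moreover have "card (f ` ?e) = 2"
    using assms(1,2,4) by (auto simp: is_cycle_def)
  ultimately show "card (f ` ?e) = card (f ` set p)" using assms(3) by simp
qed

text \<open>The tuple colouring \<open>f\<close> combines one homomorphism per label. Since the homomorphism for the label of
an edge sees whether an edge has that label, the label is a function of the colours at the two ends.\<close>

lemma bounded_if_universal:
  assumes "k \<ge> 2" "universal_for k F H" "G \<in> F" "simple_graph G"
  shows "acyclic_chromatic_number G \<le> card (verts (fst H)) ^ (2 * card (verts (fst H)))"
proof -
  let ?V = "verts (fst H)"
  let ?D = "2 * card ?V"
  have finG: "finite (verts G)" using assms(4) by (simp add: simple_graph_def)
  have H: "simple_graph (fst H)"
    using assms(2) by (auto simp: universal_for_def edge_colored_graph_def)
  then have finV: "finite ?V" by (simp add: simple_graph_def)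
  have "\<exists>v\<in>U. card {e \<in> edges G. e \<subseteq> U \<and> v \<in> e} \<le> ?D" if U: "U \<subseteq> verts G" "U \<noteq> {}" for U
    using sparse_imp_low_degree[OF assms(4) finite_subset[OF U(1) finG] U(2)
        universal_edge_bound[OF assms U(1)]] .
  from degenerate_forest_labelling[OF assms(4) finG this]
  obtain l where l: "\<And>e. e \<in> edges G \<Longrightarrow> e \<subseteq> verts G \<Longrightarrow> l e < ?D"
    and acyc: "\<And>a p. is_cycle (label_class G l a) p \<Longrightarrow> \<not> set p \<subseteq> verts G"
    by blast
  define c where "c i e = (if l e = i then 1 else 2 :: nat)" for i e
  have "\<exists>h. ec_hom (G, c i) H h" for i
    using assms by (auto simp: universal_for_def edge_colored_graph_def c_def)
  then obtain h where h: "\<And>i. ec_hom (G, c i) H (h i)" by metis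
  define f where "f v = map (\<lambda>i. h i v) [0..<?D]" for v
  have l_determined: "l e = l e'"
    if e: "e \<in> edges G" and e': "e' \<in> edges G" and eq: "f ` e = f ` e'" for e e'
  proof -
    let ?i = "l e"
    have i: "?i < ?D" using l[OF e] e assms(4) by (simp add: simple_graph_def)
    have col: "c ?i x = snd H ((\<lambda>t. t ! ?i) ` f ` x)" if x: "x \<in> edges G" for x
    proof -
      obtain u v where uv: "x = {u, v}" "u \<in> verts G" "v \<in> verts G" "adjacent G u v"
        using edge_endpoints[OF assms(4) x] .
      then have "c ?i x = snd H {h ?i u, h ?i v}"
        using h[of ?i] by (auto simp: ec_hom_def case_prod_unfold)
      then show ?thesis using uv(1) i by (simp add: f_def)
    qed
    have "c ?i e' = c ?i e" using col[OF e] col[OF e'] eq by simp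
    then show ?thesis by (simp add: c_def split: if_splits)
  qed
  have proper: "f u \<noteq> f v" if uv: "adjacent G u v" for u v
  proof
    assume eq: "f u = f v"
    have "{u, v} \<in> edges G" "{u, v} \<subseteq> verts G"
      using uv adjacent_simple[OF assms(4) uv] by (auto simp: adjacent_def)
    then have "0 < ?D" using l[of "{u, v}"] by simp
    then have "h 0 u = h 0 v" using eq by (simp add: f_def)
    moreover have "adjacent (fst H) (h 0 u) (h 0 v)"
      using h[of 0] uv adjacent_simple[OF assms(4) uv] by (auto simp: ec_hom_def case_prod_unfold)
    ultimately show False using adjacent_simple(3)[OF H] by blast
  qed
  have "card (f ` set p) \<ge> 3" if p: "is_cycle G p" for p
  proof (rule ccontr)
    assume "\<not> card (f ` set p) \<ge> 3"
    then have two: "card (f ` set p) < 3" by simp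
    let ?e = "\<lambda>i. {p ! i, p ! (Suc i mod length p)}"
    have edge: "?e i \<in> edges G" if "i < length p" for i
      using p that by (simp add: is_cycle_def adjacent_def)
    have pos: "0 < length p" using p by (auto simp: is_cycle_def)
    have image: "f ` ?e i = f ` set p" if "i < length p" for i
      using two_color_cycle_edges[OF p _ two that] proper by blast
    have "l (?e i) = l (?e 0)" if i: "i < length p" for i
      by (rule l_determined[OF edge[OF i] edge[OF pos]]) (simp only: image[OF i] image[OF pos])
    then have "is_cycle (label_class G l (l (?e 0))) p"
      using p by (simp add: is_cycle_def label_class_def adjacent_def)
    then show False using acyc p by (auto simp: is_cycle_def)
  qed
  then have "acyclic_chromatic_number G \<le> card (f ` verts G)"
    using acyclic_chromatic_number_le[where f = f, OF assms(4)] proper by blast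
  also have "\<dots> \<le> card {xs. set xs \<subseteq> ?V \<and> length xs = ?D}"
  proof (rule card_mono)
    show "finite {xs. set xs \<subseteq> ?V \<and> length xs = ?D}" using finV by (rule finite_lists_length_eq)
    show "f ` verts G \<subseteq> {xs. set xs \<subseteq> ?V \<and> length xs = ?D}"
      using h by (auto simp: f_def ec_hom_def case_prod_unfold)
  qed
  also have "\<dots> = card ?V ^ ?D" using finV by (rule card_lists_length_eq)
  finally show ?thesis .
qed

theorem theorem1:
  fixes k :: nat and F :: "'a ugraph set"
  assumes "k \<ge> 2" and "graph_class F"
  shows "(\<exists>H :: nat ecgraph. universal_for k F H) \<longleftrightarrow>
         (\<exists>r :: nat. \<forall>G\<in>F. acyclic_chromatic_number G \<le> r)"
proof
  assume "\<exists>H :: nat ecgraph. universal_for k F H"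
  then obtain H :: "nat ecgraph" where "universal_for k F H" ..
  then show "\<exists>r. \<forall>G\<in>F. acyclic_chromatic_number G \<le> r"
    using bounded_if_universal[OF assms(1)] assms(2) unfolding graph_class_def by blast
next
  assume "\<exists>r. \<forall>G\<in>F. acyclic_chromatic_number G \<le> r"
  then show "\<exists>H :: nat ecgraph. universal_for k F H"
    using universal_if_bounded[of k F] assms(1) by auto
qed

end
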